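(* Let $A$ be a commutative ring with nonzero identity and let $M$ be a Noetherian $A$-module. Then $M$ contains only finitely many minimal classical 1-absorbing prime submodules.
   Context: All rings are commutative with nonzero identity; the given module $M$ is nonzero and unital. An $A$-module is Noetherian if every submodule of it is finitely generated. A proper submodule $P$ of an $A$-module $M$ is a classical 1-absorbing prime submodule if whenever $abcm\in P$ for nonunits $a,b,c\in A$ and $m\in M$, then $abm\in P$ or $cm\in P$. A classical 1-absorbing prime submodule $P$ of $M$ is a minimal classical 1-absorbing prime submodule if for every classical 1-absorbing prime submodule $K$ of $M$ with $K\subseteq P$ one has $K=P$. *)

theory Defs
  imports "HOL-Algebra.Module"
begin

definition genmodule ::
    "('a, 'r) ring_scheme \<Rightarrow> ('a, 'b, 'm) module_scheme \<Rightarrow> 'b set \<Rightarrow> 'b set"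
  where "genmodule R M S = \<Inter>{N. submodule N R M \<and> S \<subseteq> N}"

definition noetherian_module ::
    "('a, 'r) ring_scheme \<Rightarrow> ('a, 'b, 'm) module_scheme \<Rightarrow> bool"
  where "noetherian_module R M \<longleftrightarrow>
    module R M \<and>
    (\<forall>N. submodule N R M \<longrightarrow> (\<exists>S \<subseteq> carrier M. finite S \<and> N = genmodule R M S))"

definition classical_1_absorbing_prime ::
    "('a, 'r) ring_scheme \<Rightarrow> ('a, 'b, 'm) module_scheme \<Rightarrow> 'b set \<Rightarrow> bool"
  where "classical_1_absorbing_prime R M P \<longleftrightarrow>
    submodule P R M \<and> P \<noteq> carrier M \<and>
    (\<forall>a \<in> carrier R - Units R. \<forall>b \<in> carrier R - Units R. \<forall>c \<in> carrier R - Units R.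
      \<forall>m \<in> carrier M.
        (a \<otimes>\<^bsub>R\<^esub> b \<otimes>\<^bsub>R\<^esub> c) \<odot>\<^bsub>M\<^esub> m \<in> P \<longrightarrow>
          (a \<otimes>\<^bsub>R\<^esub> b) \<odot>\<^bsub>M\<^esub> m \<in> P \<or> c \<odot>\<^bsub>M\<^esub> m \<in> P)"

definition minimal_classical_1_absorbing_prime ::
    "('a, 'r) ring_scheme \<Rightarrow> ('a, 'b, 'm) module_scheme \<Rightarrow> 'b set \<Rightarrow> bool"
  where "minimal_classical_1_absorbing_prime R M P \<longleftrightarrow>
    classical_1_absorbing_prime R M P \<and>
    (\<forall>K. classical_1_absorbing_prime R M K \<longrightarrow> K \<subseteq> P \<longrightarrow> K = P)"

end

theory Submission
  imports Defs
begin

text \<open>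
  The idea is Noetherian induction. If a proper submodule \<open>N\<close> is not classical 1-absorbing prime,
  then some nonunits \<open>a, b, c\<close> and some \<open>m\<close> satisfy \<open>abcm \<in> N\<close> while neither \<open>x = abm\<close> nor
  \<open>y = cm\<close> lies in \<open>N\<close>. A classical 1-absorbing prime \<open>P\<close> above \<open>N\<close> contains \<open>abcm\<close>, hence \<open>x\<close>
  or \<open>y\<close>, so it lies above one of the strictly larger submodules generated by \<open>N \<union> {x}\<close> and
  \<open>N \<union> {y}\<close> (\<open>classical_1_absorbing_prime_split\<close>). Repeating the split on these two produces a
  binary tree whose branches are strictly ascending, hence finite in a Noetherian module. So above
  every \<open>N\<close> there is a finite set of classical 1-absorbing primes such that each one above \<open>N\<close>
  contains a member of that set (\<open>finite_classical_1_absorbing_primes_below\<close>). Over the smallest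
  submodule, that finite set must contain every minimal classical 1-absorbing prime.

  The tree is not built explicitly: a submodule maximal among those without such a finite set is
  ruled out by the split, and the Noetherian hypothesis provides the maximal one.
\<close>

lemma subset_genmodule: "S \<subseteq> genmodule R M S"
  by (auto simp: genmodule_def)

lemma genmodule_minimal: "submodule N R M \<Longrightarrow> S \<subseteq> N \<Longrightarrow> genmodule R M S \<subseteq> N"
  by (auto simp: genmodule_def)

lemma (in module) genmodule_submodule:
  assumes "S \<subseteq> carrier M"
  shows "submodule (genmodule R M S) R M"
proof (rule submoduleI)
  show "genmodule R M S \<subseteq> carrier M"
    by (rule genmodule_minimal[OF carrier_is_submodule assms])
  show "\<zero>\<^bsub>M\<^esub> \<in> genmodule R M S"
    using subgroup.one_closed[OF submodule.axioms(1)] by (fastforce simp: genmodule_def)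
qed (auto simp: genmodule_def dest: submoduleE)

lemma (in module) chain_Union_submodule:
  assumes "\<C> \<noteq> {}" and chain: "subset.chain {N. submodule N R M} \<C>"
  shows "submodule (\<Union>\<C>) R M"
proof (rule submoduleI)
  have sub: "submodule N R M" if "N \<in> \<C>" for N
    using that chain by (auto simp: subset.chain_def)
  show "\<Union>\<C> \<subseteq> carrier M"
    using sub submoduleE(1) by blast
  show "\<zero>\<^bsub>M\<^esub> \<in> \<Union>\<C>"
    using assms(1) sub subgroup.one_closed[OF submodule.axioms(1)] by fastforce
  show "\<ominus>\<^bsub>M\<^esub> x \<in> \<Union>\<C>" if "x \<in> \<Union>\<C>" for x
    using that sub submoduleE(3) by blast
  show "a \<odot>\<^bsub>M\<^esub> x \<in> \<Union>\<C>" if "a \<in> carrier R" "x \<in> \<Union>\<C>" for a x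
    using that sub submoduleE(4) by blast
  show "x \<oplus>\<^bsub>M\<^esub> y \<in> \<Union>\<C>" if xy: "x \<in> \<Union>\<C>" "y \<in> \<Union>\<C>" for x y
  proof -
    obtain N where "N \<in> \<C>" "{x, y} \<subseteq> N"
      using finite_subset_Union_chain[of "{x, y}" \<C>] xy assms by blast
    then show ?thesis
      using sub submoduleE(5)[of N x y] by blast
  qed
qed

text \<open>
  The maximal condition follows from finite generation through Zorn's lemma: finitely many
  generators of the union of a chain already lie in one member of the chain, so the union is
  that member and stays in \<open>\<B>\<close>.
\<close>

lemma noetherian_maximal_submodule:
  assumes noeth: "noetherian_module R M"
    and "\<B> \<noteq> {}" and sub: "\<B> \<subseteq> {N. submodule N R M}"
  shows "\<exists>N\<in>\<B>. \<forall>N'\<in>\<B>. N \<subseteq> N' \<longrightarrow> N' = N"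
proof (rule subset_Zorn_nonempty[OF \<open>\<B> \<noteq> {}\<close>])
  fix \<C> assume "\<C> \<noteq> {}" and chain: "subset.chain \<B> \<C>"
  interpret module R M
    using noeth by (simp add: noetherian_module_def)
  have "\<C> \<subseteq> \<B>"
    using chain by (simp add: subset.chain_def)
  have chain': "subset.chain {N. submodule N R M} \<C>"
    using chain sub by (auto simp: subset.chain_def)
  obtain S where S: "finite S" "\<Union>\<C> = genmodule R M S"
    using noeth chain_Union_submodule[OF \<open>\<C> \<noteq> {}\<close> chain'] by (auto simp: noetherian_module_def)
  then have "S \<subseteq> \<Union>\<C>"
    using subset_genmodule by simp
  then obtain N where N: "N \<in> \<C>" "S \<subseteq> N"
    using finite_subset_Union_chain[OF \<open>finite S\<close> _ \<open>\<C> \<noteq> {}\<close> chain] by blast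
  then have "\<Union>\<C> \<subseteq> N"
    using S(2) genmodule_minimal \<open>\<C> \<subseteq> \<B>\<close> sub by blast
  then have "\<Union>\<C> = N"
    using N(1) by blast
  then show "\<Union>\<C> \<in> \<B>"
    using N(1) \<open>\<C> \<subseteq> \<B>\<close> by auto
qed

text \<open>
  This is the only place where the defining implication of classical 1-absorbing primes enters:
  a failure of it for \<open>N\<close> forces a choice between two elements on every such prime above \<open>N\<close>.
\<close>

lemma (in module) classical_1_absorbing_prime_split:
  assumes N: "submodule N R M" "N \<noteq> carrier M" "\<not> classical_1_absorbing_prime R M N"
  obtains x y where "x \<in> carrier M - N" "y \<in> carrier M - N"
    "\<And>P. classical_1_absorbing_prime R M P \<Longrightarrow> N \<subseteq> P \<Longrightarrow> x \<in> P \<or> y \<in> P"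
proof -
  obtain a b c m where abc: "a \<in> carrier R - Units R" "b \<in> carrier R - Units R"
      "c \<in> carrier R - Units R" and m: "m \<in> carrier M"
    and fail: "(a \<otimes> b \<otimes> c) \<odot>\<^bsub>M\<^esub> m \<in> N" "(a \<otimes> b) \<odot>\<^bsub>M\<^esub> m \<notin> N" "c \<odot>\<^bsub>M\<^esub> m \<notin> N"
    using N unfolding classical_1_absorbing_prime_def by blast
  show thesis
  proof (rule that)
    show "(a \<otimes> b) \<odot>\<^bsub>M\<^esub> m \<in> carrier M - N" "c \<odot>\<^bsub>M\<^esub> m \<in> carrier M - N"
      using abc m fail by auto
    show "(a \<otimes> b) \<odot>\<^bsub>M\<^esub> m \<in> P \<or> c \<odot>\<^bsub>M\<^esub> m \<in> P"
      if "classical_1_absorbing_prime R M P" "N \<subseteq> P" for P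
      using that abc m fail(1) unfolding classical_1_absorbing_prime_def by blast
  qed
qed

text \<open>
  Asking for a finite set \<open>\<F>\<close> of lower bounds, instead of for finitely many primes minimal over
  \<open>N\<close>, lets the two sets obtained from a split be combined by a plain union.
\<close>

lemma finite_classical_1_absorbing_primes_below:
  assumes noeth: "noetherian_module R M" and "submodule N R M"
  shows "\<exists>\<F>. finite \<F> \<and> \<F> \<subseteq> {P. classical_1_absorbing_prime R M P} \<and>
    (\<forall>P. classical_1_absorbing_prime R M P \<longrightarrow> N \<subseteq> P \<longrightarrow> (\<exists>Q\<in>\<F>. Q \<subseteq> P))"
proof (rule ccontr)
  assume none: "\<not> ?thesis"
  interpret module R M
    using noeth by (simp add: noetherian_module_def)
  define bounds where "bounds N \<F> \<longleftrightarrow> finite \<F> \<and> \<F> \<subseteq> {P. classical_1_absorbing_prime R M P} \<and>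
    (\<forall>P. classical_1_absorbing_prime R M P \<longrightarrow> N \<subseteq> P \<longrightarrow> (\<exists>Q\<in>\<F>. Q \<subseteq> P))" for N \<F>
  define \<B> where "\<B> = {N. submodule N R M \<and> (\<nexists>\<F>. bounds N \<F>)}"
  have "N \<in> \<B>"
    using \<open>submodule N R M\<close> none by (simp add: \<B>_def bounds_def)
  then have "\<B> \<noteq> {}"
    by blast
  moreover have "\<B> \<subseteq> {N. submodule N R M}"
    by (auto simp: \<B>_def)
  ultimately obtain N where "N \<in> \<B>" and maximal: "\<And>N'. N' \<in> \<B> \<Longrightarrow> N \<subseteq> N' \<Longrightarrow> N' = N"
    using noetherian_maximal_submodule[OF noeth] by meson
  then have N: "submodule N R M" and bad: "\<And>\<F>. \<not> bounds N \<F>"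
    by (auto simp: \<B>_def)
  have "N \<noteq> carrier M"
  proof
    assume "N = carrier M"
    \<comment> \<open>A prime above \<open>N\<close> would be both improper and proper, so the empty set of bounds suffices.\<close>
    then have "bounds N {}"
      using submoduleE(1) by (auto simp: bounds_def classical_1_absorbing_prime_def)
    then show False
      using bad by blast
  qed
  moreover have "\<not> classical_1_absorbing_prime R M N"
  proof
    assume "classical_1_absorbing_prime R M N"
    then have "bounds N {N}"
      by (simp add: bounds_def)
    then show False
      using bad by blast
  qed
  ultimately obtain x y where x: "x \<in> carrier M - N" and y: "y \<in> carrier M - N"
    and split: "\<And>P. classical_1_absorbing_prime R M P \<Longrightarrow> N \<subseteq> P \<Longrightarrow> x \<in> P \<or> y \<in> P"
    using classical_1_absorbing_prime_split[OF N] by blast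
  have larger: "\<exists>\<F>. bounds (genmodule R M (insert z N)) \<F>" if z: "z \<in> carrier M - N" for z
  proof (rule ccontr)
    assume "\<not> ?thesis"
    moreover have "submodule (genmodule R M (insert z N)) R M"
      using z submoduleE(1)[OF N] by (intro genmodule_submodule) auto
    moreover have "insert z N \<subseteq> genmodule R M (insert z N)"
      by (rule subset_genmodule)
    ultimately show False
      using z maximal[of "genmodule R M (insert z N)"] by (auto simp: \<B>_def)
  qed
  obtain \<F> where \<F>: "bounds (genmodule R M (insert x N)) \<F>"
    using larger[OF x] by (rule exE)
  obtain \<G> where \<G>: "bounds (genmodule R M (insert y N)) \<G>"
    using larger[OF y] by (rule exE)
  have "\<exists>Q\<in>\<F> \<union> \<G>. Q \<subseteq> P" if P: "classical_1_absorbing_prime R M P" "N \<subseteq> P" for P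
  proof -
    have "submodule P R M"
      using P(1) by (simp add: classical_1_absorbing_prime_def)
    moreover have "insert x N \<subseteq> P \<or> insert y N \<subseteq> P"
      using split[OF P] P(2) by blast
    ultimately have "genmodule R M (insert x N) \<subseteq> P \<or> genmodule R M (insert y N) \<subseteq> P"
      using genmodule_minimal by metis
    then show ?thesis
      using \<F> \<G> P(1) unfolding bounds_def by blast
  qed
  then have "bounds N (\<F> \<union> \<G>)"
    using \<F> \<G> by (simp add: bounds_def)
  then show False
    using bad by blast
qed

theorem theorem3:
  fixes A :: "('a, 'r) ring_scheme" and M :: "('a, 'b, 'm) module_scheme"
  assumes "cring A" and "\<one>\<^bsub>A\<^esub> \<noteq> \<zero>\<^bsub>A\<^esub>"
    and "module A M" and "carrier M \<noteq> {\<zero>\<^bsub>M\<^esub>}"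
    and "noetherian_module A M"
  shows "finite {P. minimal_classical_1_absorbing_prime A M P}"
proof -
  \<comment> \<open>The submodule generated by the empty set lies below every submodule.\<close>
  have "submodule (genmodule A M {}) A M"
    using module.genmodule_submodule[OF \<open>module A M\<close>] by blast
  then obtain \<F> where \<F>: "finite \<F>" "\<F> \<subseteq> {P. classical_1_absorbing_prime A M P}"
    and below: "\<And>P. classical_1_absorbing_prime A M P \<Longrightarrow> genmodule A M {} \<subseteq> P \<Longrightarrow> \<exists>Q\<in>\<F>. Q \<subseteq> P"
    using finite_classical_1_absorbing_primes_below[OF \<open>noetherian_module A M\<close>] by meson
  have "P \<in> \<F>" if P: "minimal_classical_1_absorbing_prime A M P" for P
  proof -
    have prime: "classical_1_absorbing_prime A M P"
      using P by (simp add: minimal_classical_1_absorbing_prime_def)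
    then have "genmodule A M {} \<subseteq> P"
      by (intro genmodule_minimal) (auto simp: classical_1_absorbing_prime_def)
    then obtain Q where "Q \<in> \<F>" "Q \<subseteq> P"
      using below prime by blast
    moreover from this have "Q = P"
      using P \<F>(2) unfolding minimal_classical_1_absorbing_prime_def by blast
    ultimately show ?thesis
      by simp
  qed
  then have "{P. minimal_classical_1_absorbing_prime A M P} \<subseteq> \<F>"
    by blast
  then show ?thesis
    using \<F>(1) by (rule finite_subset)
qed

end
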